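(* Let $N,K_A,K_B,M$ be integers with $0\le N\le M$ and $0\le K_A<K_B\le M$. For integers $k$ put $$p_k(A)=\frac{\binom{K_A}{k}\binom{M-K_A}{N-k}}{\binom{M}{N}},\qquad p_k(B)=\frac{\binom{K_B}{k}\binom{M-K_B}{N-k}}{\binom{M}{N}}.$$ Let $k^*$ be the smallest integer for which the cumulative sum exceeds $1$, i.e. $$\sum_{k\le k^*}\bigl(p_k(A)+p_k(B)\bigr)>1,\qquad \sum_{k<k^*}\bigl(p_k(A)+p_k(B)\bigr)\le 1,$$ and put $$P^*=\frac{p_{k^*}(B)}{p_{k^*}(A)+p_{k^*}(B)},\qquad \nu^*=\frac{\sum_{k\ge k^*}p_k(B)-\sum_{k<k^*}p_k(A)}{p_{k^*}(A)+p_{k^*}(B)}.$$ Then the Fisher game $\mathrm{Game}(N,K_A,K_B,M)$ has the following (symmetrical) Nash equilibrium. Player 2 chooses scenario $A$ with probability $P^*$ and scenario $B$ with probability $1-P^*$, and then picks a sequence uniformly at random from the sequences allowed in the chosen scenario. Player 1 samples $N$ of the $M$ positions uniformly at random (uniformly among all $N$-element subsets of positions); with $k$ the number of $1$s observed in the sample, she guesses $A$ if $k<k^*$, guesses $B$ if $k>k^*$, and if $k=k^*$ she guesses $A$ with probability $\nu^*$ and $B$ with probability $1-\nu^*$.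
   Context: Fisher game $\mathrm{Game}(N,K_A,K_B,M)$: Player 2 first chooses a scenario $A$ or $B$ and then a binary sequence in $\{0,1\}^M$ containing exactly $K_A$ ones (if $A$) or exactly $K_B$ ones (if $B$); these are the allowed sequences $\mathcal K_A$, $\mathcal K_B$ of the scenarios. Player 1, not knowing Player 2's choice, chooses an $N$-element set $S\subset\{1,\dots,M\}$ of positions, observes the bits of the sequence at these positions, and on the basis of the observed bits guesses $A$ or $B$. Thus a pure action of Player 1 is a pair $(S,\phi)$ with $|S|=N$ and $\phi:\{0,1\}^N\to\{A,B\}$. Player 1 wins (utility $1$) if her guess is the scenario chosen by Player 2 and loses (utility $0$) otherwise; the game is zero-sum (up to a constant: Player 2 wins exactly when Player 1 loses). Nash equilibrium means Nash equilibrium in mixed strategies. Binomial coefficients $\binom{a}{b}$ with $b<0$ or $b>a$ are $0$. *)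

theory Defs
  imports "HOL-Probability.Probability"
begin

section \<open>Mixed Nash equilibria of two-player games\<close>

definition mixed :: "'a set \<Rightarrow> 'a pmf set" where
  "mixed X = {\<sigma>. set_pmf \<sigma> \<subseteq> X}"

definition expected_utility :: "('a \<Rightarrow> 'b \<Rightarrow> real) \<Rightarrow> 'a pmf \<Rightarrow> 'b pmf \<Rightarrow> real" where
  "expected_utility u \<sigma> \<tau> = measure_pmf.expectation (pair_pmf \<sigma> \<tau>) (\<lambda>(a, b). u a b)"

definition mixed_nash ::
  "'a set \<Rightarrow> 'b set \<Rightarrow> ('a \<Rightarrow> 'b \<Rightarrow> real) \<Rightarrow> ('a \<Rightarrow> 'b \<Rightarrow> real) \<Rightarrow> 'a pmf \<Rightarrow> 'b pmf \<Rightarrow> bool"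
where
  "mixed_nash X Y u1 u2 \<sigma> \<tau> \<longleftrightarrow>
     \<sigma> \<in> mixed X \<and> \<tau> \<in> mixed Y \<and>
     (\<forall>\<sigma>'\<in>mixed X. expected_utility u1 \<sigma>' \<tau> \<le> expected_utility u1 \<sigma> \<tau>) \<and>
     (\<forall>\<tau>'\<in>mixed Y. expected_utility u2 \<sigma> \<tau>' \<le> expected_utility u2 \<sigma> \<tau>)"


section \<open>The Fisher game\<close>

text \<open>
  A binary sequence is a list of Booleans, with True for the bit 1. Positions are list
  indices, so the position set is {0, ..., M - 1} rather than {1, ..., M}.
\<close>

datatype scenario = Scen_A | Scen_B

fun num_ones :: "nat \<Rightarrow> nat \<Rightarrow> scenario \<Rightarrow> nat" where
  "num_ones KA KB Scen_A = KA"
| "num_ones KA KB Scen_B = KB"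

definition allowed :: "nat \<Rightarrow> nat \<Rightarrow> bool list set" where
  "allowed M K = {x. length x = M \<and> count_list x True = K}"

definition samples :: "nat \<Rightarrow> nat \<Rightarrow> nat set set" where
  "samples N M = {S. S \<subseteq> {..<M} \<and> card S = N}"

definition words :: "nat \<Rightarrow> bool list set" where
  "words N = {w. length w = N}"

text \<open>
  A pure action of Player 1 is a pair (S, phi), where phi is extensional (undefined outside
  the words of length N), so that different actions differ on some word of length N.
\<close>

definition actions1 :: "nat \<Rightarrow> nat \<Rightarrow> (nat set \<times> (bool list \<Rightarrow> scenario)) set" where
  "actions1 N M = samples N M \<times> (words N \<rightarrow>\<^sub>E UNIV)"

definition actions2 :: "nat \<Rightarrow> nat \<Rightarrow> nat \<Rightarrow> (scenario \<times> bool list) set" where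
  "actions2 KA KB M = (SIGMA s:UNIV. allowed M (num_ones KA KB s))"

text \<open>
  The observed word lists the bits of the sequence at the sampled positions in increasing
  order of position, which is what nths computes.
\<close>

fun utility1 :: "nat set \<times> (bool list \<Rightarrow> scenario) \<Rightarrow> scenario \<times> bool list \<Rightarrow> real" where
  "utility1 (S, \<phi>) (s, x) = (if \<phi> (nths x S) = s then 1 else 0)"

definition utility2 :: "nat set \<times> (bool list \<Rightarrow> scenario) \<Rightarrow> scenario \<times> bool list \<Rightarrow> real" where
  "utility2 a b = 1 - utility1 a b"

definition fisher_nash ::
  "nat \<Rightarrow> nat \<Rightarrow> nat \<Rightarrow> nat \<Rightarrow> (nat set \<times> (bool list \<Rightarrow> scenario)) pmf \<Rightarrow>
   (scenario \<times> bool list) pmf \<Rightarrow> bool"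
where
  "fisher_nash N KA KB M = mixed_nash (actions1 N M) (actions2 KA KB M) utility1 utility2"


section \<open>The equilibrium strategies\<close>

text \<open>
  Binomial coefficients with an integer lower index, zero if that index is negative. With
  truncated subtraction on nat, the index N - k would become 0 instead of negative for k > N.
\<close>

definition binom :: "nat \<Rightarrow> int \<Rightarrow> nat" where
  "binom a b = (if b < 0 then 0 else a choose nat b)"

definition obs_prob :: "nat \<Rightarrow> nat \<Rightarrow> nat \<Rightarrow> int \<Rightarrow> real" where
  "obs_prob N M K k =
     real (binom K k) * real (binom (M - K) (int N - k)) / real (M choose N)"

text \<open>
  Sums over unbounded ranges of integers are rendered by infsum; only the terms with
  k between 0 and N can be nonzero.
\<close>

definition kstar :: "nat \<Rightarrow> nat \<Rightarrow> nat \<Rightarrow> nat \<Rightarrow> int" where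
  "kstar N KA KB M =
     (LEAST j. (\<Sum>\<^sub>\<infinity>k\<in>{..j}. obs_prob N M KA k + obs_prob N M KB k) > 1)"

definition Pstar :: "nat \<Rightarrow> nat \<Rightarrow> nat \<Rightarrow> nat \<Rightarrow> real" where
  "Pstar N KA KB M =
     (let ks = kstar N KA KB M
      in obs_prob N M KB ks / (obs_prob N M KA ks + obs_prob N M KB ks))"

definition nustar :: "nat \<Rightarrow> nat \<Rightarrow> nat \<Rightarrow> nat \<Rightarrow> real" where
  "nustar N KA KB M =
     (let ks = kstar N KA KB M
      in ((\<Sum>\<^sub>\<infinity>k\<in>{ks..}. obs_prob N M KB k) - (\<Sum>\<^sub>\<infinity>k\<in>{..<ks}. obs_prob N M KA k)) /
         (obs_prob N M KA ks + obs_prob N M KB ks))"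

text \<open>
  The library's Bernoulli distribution clips its parameter to [0,1], so this has its intended
  meaning only for p in [0,1].
\<close>

definition A_with_prob :: "real \<Rightarrow> scenario pmf" where
  "A_with_prob p = map_pmf (\<lambda>b. if b then Scen_A else Scen_B) (bernoulli_pmf p)"

definition strategy2 :: "nat \<Rightarrow> nat \<Rightarrow> nat \<Rightarrow> nat \<Rightarrow> (scenario \<times> bool list) pmf" where
  "strategy2 N KA KB M =
     do {
       s \<leftarrow> A_with_prob (Pstar N KA KB M);
       x \<leftarrow> pmf_of_set (allowed M (num_ones KA KB s));
       return_pmf (s, x)
     }"

definition guess :: "nat \<Rightarrow> nat \<Rightarrow> nat \<Rightarrow> nat \<Rightarrow> bool list \<Rightarrow> scenario pmf" where
  "guess N KA KB M w =
     (let k = int (count_list w True); ks = kstar N KA KB M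
      in if k < ks then return_pmf Scen_A
         else if k > ks then return_pmf Scen_B
         else A_with_prob (nustar N KA KB M))"

text \<open>
  As a mixture of pure actions: the positions are uniform, and the decision function is drawn
  by drawing, for every word w independently, the guess at w from the distribution guess w.
\<close>

definition strategy1 ::
  "nat \<Rightarrow> nat \<Rightarrow> nat \<Rightarrow> nat \<Rightarrow> (nat set \<times> (bool list \<Rightarrow> scenario)) pmf"
where
  "strategy1 N KA KB M =
     do {
       S \<leftarrow> pmf_of_set (samples N M);
       \<phi> \<leftarrow> Pi_pmf (words N) undefined (guess N KA KB M);
       return_pmf (S, \<phi>)
     }"

end

theory Submission
  imports Defs
begin

text \<open>
  The two strategies form a saddle point: there is one number \<open>v\<close> such that Player 1's strategy
  wins with probability \<open>v\<close> against every allowed sequence, while against Player 2's strategy no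
  pure action wins with probability more than \<open>v\<close>. Linearity of the expected utility carries both
  bounds over to mixed deviations, which makes the pair a Nash equilibrium
  (\<open>mixed_nash_saddle_point\<close>).

  \<^emph>\<open>Player 1 makes Player 2 indifferent.\<close> When the positions are sampled uniformly, the number of
  ones seen in any fixed sequence with \<open>K\<close> ones is hypergeometric, whatever the arrangement of the
  ones (\<open>card_samples_with_ones\<close>). So only the scenario matters to the winning probability, which is
  \<open>(\<Sum>k<k*. p\<^sub>k(A)) + \<nu> p\<^sub>k\<^sub>*(A)\<close> in scenario A and \<open>(1 - \<nu>) p\<^sub>k\<^sub>*(B) + (\<Sum>k>k*. p\<^sub>k(B))\<close> in
  scenario B. The formula for \<open>\<nu>*\<close> is the solution of the equation between the two
  (\<open>threshold_rule_indifferent\<close>), and the choice of \<open>k*\<close> puts this solution in \<open>[0,1]\<close>: the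
  numerator of \<open>\<nu>*\<close> is 1 minus the cumulative sum below \<open>k*\<close>, hence nonnegative, and smaller than
  the term \<open>p\<^sub>k\<^sub>*(A) + p\<^sub>k\<^sub>*(B)\<close> that takes the cumulative sum above 1.

  \<^emph>\<open>Player 2 makes the threshold rule a best reply.\<close> When the sequence is uniform in its scenario,
  the probability of the observed word depends only on its number \<open>k\<close> of ones
  (\<open>card_allowed_with_word\<close>), whichever positions were chosen. Call it \<open>q\<^sub>k(A)\<close> or \<open>q\<^sub>k(B)\<close>. The
  best reply guesses A where \<open>P q\<^sub>k(A)\<close> exceeds \<open>(1 - P) q\<^sub>k(B)\<close>. Double counting gives
  \<open>p\<^sub>k = C(N,k) q\<^sub>k\<close>, so the prior \<open>P*\<close> equates the two sides at \<open>k = k*\<close>; and since binomial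
  coefficients are log-concave, the likelihood ratio is monotone in \<open>k\<close>
  (\<open>word_prob_monotone_likelihood_ratio\<close>), so A is the better guess below \<open>k*\<close> and B above it. Hence
  the threshold rule is optimal for any choice of positions, and its value against \<open>P*\<close> is the
  average \<open>P v + (1 - P) v = v\<close>.
\<close>

section \<open>Saddle points\<close>

lemma expected_utility_finite:
  assumes "finite X" "finite Y" "\<sigma> \<in> mixed X" "\<tau> \<in> mixed Y"
  shows "expected_utility u \<sigma> \<tau> = (\<Sum>a\<in>X. \<Sum>b\<in>Y. pmf \<sigma> a * pmf \<tau> b * u a b)"
proof -
  have "expected_utility u \<sigma> \<tau> =
      (\<Sum>c\<in>X \<times> Y. pmf (pair_pmf \<sigma> \<tau>) c *\<^sub>R (case c of (a, b) \<Rightarrow> u a b))"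
    unfolding expected_utility_def using assms
    by (intro integral_measure_pmf) (auto simp: mixed_def)
  also have "\<dots> = (\<Sum>(a, b)\<in>X \<times> Y. pmf \<sigma> a * pmf \<tau> b * u a b)"
    by (intro sum.cong) (auto simp: pmf_pair)
  finally show ?thesis
    by (simp add: sum.cartesian_product)
qed

lemma expectation_finite_mixed:
  fixes f :: "'a \<Rightarrow> real"
  assumes "finite X" "\<sigma> \<in> mixed X"
  shows "measure_pmf.expectation \<sigma> f = (\<Sum>a\<in>X. pmf \<sigma> a * f a)"
  using assms by (subst integral_measure_pmf[of X]) (auto simp: mixed_def)

text \<open>
  In a game of constant sum it is enough to bound the payoff at pure deviations. A mixed deviation
  averages these bounds; and the two bounds together force the payoff at the pair itself to
  be \<open>v\<close>.
\<close>
lemma mixed_nash_saddle_point: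
  fixes u :: "'a \<Rightarrow> 'b \<Rightarrow> real"
  assumes fin: "finite X" "finite Y" and \<sigma>: "\<sigma> \<in> mixed X" and \<tau>: "\<tau> \<in> mixed Y"
    and secure: "\<And>b. b \<in> Y \<Longrightarrow> v \<le> measure_pmf.expectation \<sigma> (\<lambda>a. u a b)"
    and cap: "\<And>a. a \<in> X \<Longrightarrow> measure_pmf.expectation \<tau> (u a) \<le> v"
  shows "mixed_nash X Y u (\<lambda>a b. 1 - u a b) \<sigma> \<tau>"
proof -
  have le: "expected_utility u \<sigma>' \<tau> \<le> v" if \<sigma>': "\<sigma>' \<in> mixed X" for \<sigma>'
  proof -
    have "expected_utility u \<sigma>' \<tau> = (\<Sum>a\<in>X. pmf \<sigma>' a * measure_pmf.expectation \<tau> (u a))"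
      by (simp add: expected_utility_finite[OF fin \<sigma>' \<tau>] expectation_finite_mixed[OF fin(2) \<tau>]
          sum_distrib_left mult_ac)
    also have "\<dots> \<le> (\<Sum>a\<in>X. pmf \<sigma>' a * v)"
      by (intro sum_mono mult_left_mono cap) auto
    also have "\<dots> = v"
      using \<sigma>' fin by (simp flip: sum_distrib_right add: mixed_def sum_pmf_eq_1)
    finally show ?thesis .
  qed
  have ge: "v \<le> expected_utility u \<sigma> \<tau>'" if \<tau>': "\<tau>' \<in> mixed Y" for \<tau>'
  proof -
    have "v = (\<Sum>b\<in>Y. pmf \<tau>' b * v)"
      using \<tau>' fin by (simp flip: sum_distrib_right add: mixed_def sum_pmf_eq_1)
    also have "\<dots> \<le> (\<Sum>b\<in>Y. pmf \<tau>' b * measure_pmf.expectation \<sigma> (\<lambda>a. u a b))"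
      by (intro sum_mono mult_left_mono secure) auto
    also have "\<dots> = (\<Sum>b\<in>Y. \<Sum>a\<in>X. pmf \<sigma> a * pmf \<tau>' b * u a b)"
      by (simp add: expectation_finite_mixed[OF fin(1) \<sigma>] sum_distrib_left mult_ac)
    also have "\<dots> = expected_utility u \<sigma> \<tau>'"
      by (subst sum.swap) (simp add: expected_utility_finite[OF fin \<sigma> \<tau>'])
    finally show ?thesis .
  qed
  have compl: "expected_utility (\<lambda>a b. 1 - u a b) \<sigma> \<tau>' = 1 - expected_utility u \<sigma> \<tau>'"
    if \<tau>': "\<tau>' \<in> mixed Y" for \<tau>'
  proof -
    have "(\<Sum>a\<in>X. \<Sum>b\<in>Y. pmf \<sigma> a * pmf \<tau>' b) = (\<Sum>a\<in>X. pmf \<sigma> a) * (\<Sum>b\<in>Y. pmf \<tau>' b)"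
      by (simp add: sum_product)
    also have "\<dots> = 1"
      using \<sigma> \<tau>' fin by (simp add: mixed_def sum_pmf_eq_1)
    finally show ?thesis
      by (simp add: expected_utility_finite[OF fin \<sigma> \<tau>'] algebra_simps sum_subtractf)
  qed
  show ?thesis
    unfolding mixed_nash_def
  proof (intro conjI ballI)
    fix \<sigma>' assume "\<sigma>' \<in> mixed X"
    then show "expected_utility u \<sigma>' \<tau> \<le> expected_utility u \<sigma> \<tau>"
      using le ge[OF \<tau>] by fastforce
  next
    fix \<tau>' assume "\<tau>' \<in> mixed Y"
    then show "expected_utility (\<lambda>a b. 1 - u a b) \<sigma> \<tau>' \<le> expected_utility (\<lambda>a b. 1 - u a b) \<sigma> \<tau>"
      using ge le[OF \<sigma>] \<tau> by (fastforce simp: compl)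
  qed (use \<sigma> \<tau> in auto)
qed


section \<open>Counting words and samples\<close>

lemma finite_words: "finite (words N)"
  and card_words: "card (words N) = 2 ^ N"
  using finite_lists_length_eq[of "UNIV :: bool set" N] card_lists_length_eq[of "UNIV :: bool set" N]
  by (simp_all add: words_def)

lemma finite_allowed: "finite (allowed M K)"
  by (rule finite_subset[OF _ finite_words[of M]]) (auto simp: allowed_def words_def)

lemma finite_samples: "finite (samples N M)"
  by (rule finite_subset[of _ "Pow {..<M}"]) (auto simp: samples_def)

lemma card_samples: "card (samples N M) = M choose N"
  by (simp add: samples_def n_subsets)

lemma samples_nonempty: "N \<le> M \<Longrightarrow> samples N M \<noteq> {}"
  using card_samples[of N M] by auto

lemma count_nths: "count_list (nths x S) True = card {i \<in> S. i < length x \<and> x ! i}"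
proof (induction x rule: rev_induct)
  case (snoc a x)
  have "{i \<in> S. i < length (x @ [a]) \<and> (x @ [a]) ! i} =
      {i \<in> S. i < length x \<and> x ! i} \<union> (if length x \<in> S \<and> a then {length x} else {})"
    by (auto simp: nth_append less_Suc_eq split: if_splits)
  then have "card {i \<in> S. i < length (x @ [a]) \<and> (x @ [a]) ! i} =
      card {i \<in> S. i < length x \<and> x ! i} + (if length x \<in> S \<and> a then 1 else 0)"
    by (auto simp: card_Un_disjoint)
  then show ?case
    using snoc by (simp add: nths_append nths_Cons)
qed simp

lemma count_nths_add_compl:
  "count_list (nths x S) v + count_list (nths x (- S)) v = count_list x v"
  by (induction x rule: rev_induct) (auto simp: nths_append)

lemma nths_eq_imp_eq:
  assumes "length x = length y" "nths x S = nths y S" "nths x (- S) = nths y (- S)"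
  shows "x = y"
  using assms
proof (induction x y arbitrary: S rule: list_induct2)
  case (Cons a x b y)
  show ?case
    using Cons.IH[of "{j. Suc j \<in> S}"] Cons.prems
    by (cases "0 \<in> S") (auto simp: nths_Cons Collect_neg_eq)
qed simp

lemma length_nths_sample:
  assumes "S \<in> samples N M" "length x = M"
  shows "length (nths x S) = N" "length (nths x (- S)) = M - N"
proof -
  have S: "S \<subseteq> {..<M}" "card S = N" "finite S"
    using assms finite_subset[of S "{..<M}"] by (auto simp: samples_def)
  then have "{i. i < M \<and> i \<in> S} = S" "{i. i < M \<and> i \<in> - S} = {..<M} - S"
    by auto
  then show "length (nths x S) = N" "length (nths x (- S)) = M - N"
    using S assms by (simp_all only: length_nths) (auto simp: card_Diff_subset)
qed

text \<open>
  A sequence is determined by its sampled part and its unsampled part. That the two parts are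
  arbitrary needs no construction of the merged sequence: the map is injective between sets of the
  same size, \<open>2^M = 2^N * 2^(M - N)\<close>.
\<close>
lemma bij_betw_split_word:
  assumes "N \<le> M" "S \<in> samples N M"
  shows "bij_betw (\<lambda>x. (nths x S, nths x (- S))) (words M) (words N \<times> words (M - N))"
proof -
  let ?f = "\<lambda>x. (nths x S, nths x (- S))"
  have inj: "inj_on ?f (words M)"
  proof (rule inj_onI)
    fix x y assume "x \<in> words M" "y \<in> words M" "?f x = ?f y"
    then show "x = y"
      by (intro nths_eq_imp_eq[of x y S]) (simp_all add: words_def)
  qed
  have sub: "?f ` words M \<subseteq> words N \<times> words (M - N)"
    using length_nths_sample[OF assms(2)] by (auto simp: words_def)
  have "card (?f ` words M) = 2 ^ (N + (M - N))"
    using assms(1) by (simp add: card_image[OF inj] card_words)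
  then have "card (?f ` words M) = card (words N \<times> words (M - N))"
    by (simp only: card_cartesian_product card_words power_add)
  then have "?f ` words M = words N \<times> words (M - N)"
    by (intro card_subset_eq sub) (simp_all add: finite_words)
  with inj show ?thesis
    by (simp add: bij_betw_def)
qed

lemma card_allowed: "card (allowed M K) = M choose K"
proof (induction M arbitrary: K)
  case 0
  have "allowed 0 K = (if K = 0 then {[]} else {})"
    by (auto simp: allowed_def)
  then show ?case by (cases K) auto
next
  case (Suc M)
  show ?case
  proof (cases K)
    case 0
    have "allowed (Suc M) 0 = Cons False ` allowed M 0"
      by (auto simp: allowed_def length_Suc_conv split: if_splits)
    then show ?thesis
      using Suc 0 by (simp add: card_image)
  next
    case (Suc k)
    have "allowed (Suc M) K = Cons False ` allowed M K \<union> Cons True ` allowed M k"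
      by (auto simp: allowed_def length_Suc_conv Suc split: if_splits)
    moreover have "Cons False ` allowed M K \<inter> Cons True ` allowed M k = {}"
      by auto
    ultimately show ?thesis
      using Suc.IH Suc by (simp add: card_Un_disjoint finite_allowed card_image)
  qed
qed

lemma allowed_nonempty: "K \<le> M \<Longrightarrow> allowed M K \<noteq> {}"
  using card_allowed[of M K] by auto

text \<open>
  A sample showing \<open>k\<close> ones consists of \<open>k\<close> of the positions that carry a one and \<open>N - k\<close> of those
  that carry a zero. The number of such samples is therefore the same for all sequences of the
  scenario, which is why a uniform sample leaves Player 2 nothing to gain from the arrangement
  of the ones.
\<close>
lemma card_samples_with_ones:
  assumes "x \<in> allowed M K" "k \<le> N"
  shows "card {S \<in> samples N M. count_list (nths x S) True = k} = (K choose k) * (M - K choose (N - k))"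
proof -
  define T where "T = {i. i < M \<and> x ! i}"
  have T: "T \<subseteq> {..<M}" "finite T"
    by (auto simp: T_def)
  have len: "length x = M"
    using assms by (simp add: allowed_def)
  have cT: "card T = K"
    using count_nths[of x UNIV] assms len by (simp add: allowed_def T_def nths_all)
  have cnt: "count_list (nths x S) True = card (S \<inter> T)" for S
    unfolding count_nths len T_def by (rule arg_cong[of _ _ card]) auto
  let ?C = "{A. A \<subseteq> T \<and> card A = k} \<times> {B. B \<subseteq> {..<M} - T \<and> card B = N - k}"
  have "bij_betw (\<lambda>S. (S \<inter> T, S - T)) {S \<in> samples N M. count_list (nths x S) True = k} ?C"
  proof (rule bij_betw_byWitness[where f' = "\<lambda>(A, B). A \<union> B"])
    have "S \<inter> T \<subseteq> T \<and> card (S \<inter> T) = k \<and> S - T \<subseteq> {..<M} - T \<and> card (S - T) = N - k"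
      if S: "S \<in> samples N M" "count_list (nths x S) True = k" for S
    proof -
      have "finite S"
        using S by (auto simp: samples_def intro: finite_subset)
      then show ?thesis
        using S cnt[of S] by (auto simp: samples_def card_Diff_subset_Int)
    qed
    then show "(\<lambda>S. (S \<inter> T, S - T)) ` {S \<in> samples N M. count_list (nths x S) True = k} \<subseteq> ?C"
      by auto
    have "A \<union> B \<in> samples N M \<and> count_list (nths x (A \<union> B)) True = k"
      if AB: "A \<subseteq> T" "card A = k" "B \<subseteq> {..<M} - T" "card B = N - k" for A B
    proof -
      have "finite A" "finite B" "A \<inter> B = {}" "(A \<union> B) \<inter> T = A"
        using AB T by (auto intro: finite_subset)
      then show ?thesis
        using AB T assms by (auto simp: samples_def cnt card_Un_disjoint)
    qed
    then show "(\<lambda>(A, B). A \<union> B) ` ?C \<subseteq> {S \<in> samples N M. count_list (nths x S) True = k}"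
      by auto
  qed auto
  then have "card {S \<in> samples N M. count_list (nths x S) True = k} = card ?C"
    by (rule bij_betw_same_card)
  also have "\<dots> = (K choose k) * (M - K choose (N - k))"
    using T cT by (simp add: card_cartesian_product n_subsets card_Diff_subset)
  finally show ?thesis .
qed

text \<open>
  Once the sampled part is fixed, the unsampled part is any word with the remaining
  \<open>K - count_list w True\<close> ones. The number does not depend on \<open>S\<close>: against a uniform sequence, no
  choice of positions is better than another.
\<close>
lemma card_allowed_with_word:
  assumes "N \<le> M" "S \<in> samples N M" "w \<in> words N"
  shows "card {x \<in> allowed M K. nths x S = w} =
    (if count_list w True \<le> K then M - N choose (K - count_list w True) else 0)"
proof -
  let ?f = "\<lambda>x. (nths x S, nths x (- S))"
  let ?C = "{v \<in> words (M - N). count_list w True + count_list v True = K}"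
  have bij: "bij_betw ?f (words M) (words N \<times> words (M - N))"
    by (rule bij_betw_split_word[OF assms(1,2)])
  have "?f ` {x \<in> allowed M K. nths x S = w} = {w} \<times> ?C"
  proof (intro equalityI subsetI)
    fix p assume "p \<in> {w} \<times> ?C"
    then obtain v where v: "p = (w, v)" "v \<in> ?C" by auto
    then have "(w, v) \<in> ?f ` words M"
      using bij assms(3) by (auto simp: bij_betw_def)
    then obtain x where "x \<in> words M" "w = nths x S" "v = nths x (- S)" by auto
    then show "p \<in> ?f ` {x \<in> allowed M K. nths x S = w}"
      using v count_nths_add_compl[of x S True] by (auto simp: allowed_def words_def)
  qed (use length_nths_sample[OF assms(2)] count_nths_add_compl[of _ S True] in
       \<open>auto simp: allowed_def words_def\<close>)
  moreover have inj: "inj_on ?f {x \<in> allowed M K. nths x S = w}"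
    using bij by (rule inj_on_subset[OF bij_betw_imp_inj_on]) (auto simp: allowed_def words_def)
  ultimately have "card {x \<in> allowed M K. nths x S = w} = card ({w} \<times> ?C)"
    using card_image[OF inj] by argo
  moreover have "?C = (if count_list w True \<le> K then allowed (M - N) (K - count_list w True) else {})"
    by (auto simp: words_def allowed_def)
  ultimately show ?thesis
    by (simp add: card_cartesian_product card_allowed)
qed

lemma count_le_of_words: "w \<in> words N \<Longrightarrow> count_list w True \<le> N"
  using count_le_length[of w True] by (simp add: words_def)

lemma sum_words_by_ones:
  fixes f :: "nat \<Rightarrow> real"
  shows "(\<Sum>w\<in>words N. f (count_list w True)) = (\<Sum>k\<le>N. real (N choose k) * f k)"
proof -
  have "(\<Sum>w\<in>words N. f (count_list w True)) =
      (\<Sum>k\<le>N. \<Sum>w\<in>{w \<in> words N. count_list w True = k}. f (count_list w True))"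
    by (rule sum.group[symmetric]) (auto simp: finite_words count_le_of_words)
  also have "\<dots> = (\<Sum>k\<le>N. real (N choose k) * f k)"
  proof (intro sum.cong refl)
    fix k
    have "{w \<in> words N. count_list w True = k} = allowed N k"
      by (auto simp: words_def allowed_def)
    moreover have "(\<Sum>w\<in>{w \<in> words N. count_list w True = k}. f (count_list w True)) =
        (\<Sum>w\<in>{w \<in> words N. count_list w True = k}. f k)"
      by (intro sum.cong) auto
    ultimately show "(\<Sum>w\<in>{w \<in> words N. count_list w True = k}. f (count_list w True)) = real (N choose k) * f k"
      by (simp add: card_allowed)
  qed
  finally show ?thesis .
qed


section \<open>The law of the observation\<close>

text \<open>
  The probability that a uniform sequence of length \<open>M\<close> with \<open>K\<close> ones shows, at \<open>N\<close> given positions,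
  one particular word with \<open>k\<close> ones. The case distinction prevents \<open>K - k\<close> from being truncated
  to 0 when the word has more ones than the sequence.
\<close>
definition word_prob :: "nat \<Rightarrow> nat \<Rightarrow> nat \<Rightarrow> nat \<Rightarrow> real" where
  "word_prob N M K k = (if k \<le> K then real (M - N choose (K - k)) / real (M choose K) else 0)"

lemma obs_prob_of_nat:
  "k \<le> N \<Longrightarrow> obs_prob N M K (int k) =
    real (K choose k) * real (M - K choose (N - k)) / real (M choose N)"
  by (simp add: obs_prob_def binom_def nat_diff_distrib)

lemma obs_prob_eq_0: "k < 0 \<or> int N < k \<Longrightarrow> obs_prob N M K k = 0"
  by (auto simp: obs_prob_def binom_def)

lemma obs_prob_nonneg: "obs_prob N M K k \<ge> 0"
  by (simp add: obs_prob_def)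

text \<open>Both sides count the pairs of disjoint sets of sizes \<open>a\<close> and \<open>b\<close> among \<open>n\<close> elements.\<close>
lemma choose_mult_choose_swap:
  "(n choose a) * (n - a choose b) = (n choose b) * (n - b choose (a :: nat))"
proof (cases "a + b \<le> n")
  case True
  then show ?thesis
    using choose_mult[of a "a + b" n] choose_mult[of b "a + b" n]
      binomial_symmetric[of a "a + b"] by simp
next
  case False
  then have "n < a \<or> n - a < b" "n < b \<or> n - b < a"
    by arith+
  then show ?thesis by (auto simp: binomial_eq_0)
qed

text \<open>
  The hypergeometric law arises in two ways: from a uniform sample in a fixed sequence, and from a
  uniform sequence at fixed positions, where \<open>N choose k\<close> words have \<open>k\<close> ones. This is what
  connects the weights in \<open>k*\<close>, \<open>P*\<close> and \<open>\<nu>*\<close>, which speak of the number of ones, with Player 1's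
  decision, which is made word by word.
\<close>
lemma obs_prob_eq_word_prob:
  assumes "N \<le> M" "K \<le> M" "k \<le> N"
  shows "obs_prob N M K (int k) = real (N choose k) * word_prob N M K k"
proof (cases "k \<le> K")
  case True
  have "(M choose K) * (K choose k) * (M - K choose (N - k)) =
      (M choose k) * ((M - k choose (K - k)) * (M - k - (K - k) choose (N - k)))"
    using choose_mult[OF True assms(2)] True by simp
  also have "\<dots> = (M choose k) * (M - k choose (N - k)) * (M - k - (N - k) choose (K - k))"
    by (simp only: choose_mult_choose_swap mult.assoc)
  also have "\<dots> = (M choose N) * (N choose k) * (M - N choose (K - k))"
    using choose_mult[OF assms(3,1)] assms(3) by simp
  finally have "real ((M choose K) * (K choose k) * (M - K choose (N - k))) =
      real ((M choose N) * (N choose k) * (M - N choose (K - k)))"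
    by (rule arg_cong)
  then show ?thesis
    using True assms by (simp add: obs_prob_of_nat word_prob_def field_simps)
qed (simp add: obs_prob_of_nat[OF assms(3)] word_prob_def binomial_eq_0)

lemma sum_obs_prob:
  assumes "N \<le> M" "K \<le> M"
  shows "(\<Sum>k\<le>N. obs_prob N M K (int k)) = 1"
proof -
  have "(\<Sum>k\<le>N. obs_prob N M K (int k)) =
      real (\<Sum>k\<le>N. (K choose k) * (M - K choose (N - k))) / real (M choose N)"
    by (simp add: obs_prob_of_nat flip: sum_divide_distrib)
  then show ?thesis
    using assms by (simp only: vandermonde) simp
qed

text \<open>
  Of two products of binomial coefficients with the same sum of lower indices, the one with the
  indices closer together is larger. The step \<open>d = 1\<close> holds because \<open>(n choose (i + 1)) / (n choose i)\<close>
  \<open>= (n - i) / (i + 1)\<close> decreases in \<open>i\<close>; the induction multiplies such steps.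
\<close>
lemma binomial_log_concave:
  fixes n a b d :: nat
  assumes "a \<le> b"
  shows "(n choose a) * (n choose (b + d)) \<le> (n choose (a + d)) * (n choose b)"
proof (induction d)
  case (Suc d)
  let ?c = "\<lambda>i. n choose i"
  have step: "?c i * ?c (Suc j) \<le> ?c (Suc i) * ?c j" if "i \<le> j" for i j
  proof -
    have rec: "Suc i * ?c (Suc i) = (n - i) * ?c i" for i
      by (metis binomial_absorb_comp binomial_absorption)
    have "Suc j * (?c i * ?c (Suc j)) = (n - j) * (?c i * ?c j)"
      by (metis rec mult.left_commute)
    also have "\<dots> \<le> (n - i) * (?c i * ?c j)"
      using that by (intro mult_right_mono diff_le_mono2) auto
    also have "\<dots> = Suc i * (?c (Suc i) * ?c j)"
      by (metis rec mult.assoc)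
    also have "\<dots> \<le> Suc j * (?c (Suc i) * ?c j)"
      using that by simp
    finally show ?thesis
      using mult_le_cancel1 by blast
  qed
  show ?case
  proof (cases "b + d < n")
    case True
    \<comment> \<open>Both sides carry the factor \<open>?c (a + d) * ?c (b + d)\<close>, which is positive and cancels.\<close>
    have "(?c a * ?c (b + Suc d)) * (?c (a + d) * ?c (b + d)) =
        (?c a * ?c (b + d)) * (?c (a + d) * ?c (Suc (b + d)))"
      by simp
    also have "\<dots> \<le> (?c (a + d) * ?c b) * (?c (Suc (a + d)) * ?c (b + d))"
      using assms by (intro mult_mono Suc.IH step) auto
    also have "\<dots> = (?c (a + Suc d) * ?c b) * (?c (a + d) * ?c (b + d))"
      by simp
    finally show ?thesis
      using True assms by simp
  qed (simp add: binomial_eq_0)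
qed simp

text \<open>
  The ratio of the probabilities under B and A increases with the number of ones seen. After
  clearing the normalizing constants, the lower indices \<open>KA - k\<close> and \<open>KB - j\<close> on the left enclose
  those on the right, and the sums agree, so this is log-concavity.
\<close>
lemma word_prob_monotone_likelihood_ratio:
  assumes "KA \<le> KB" "j \<le> k"
  shows "word_prob N M KA k * word_prob N M KB j \<le> word_prob N M KA j * word_prob N M KB k"
proof (cases "k \<le> KA")
  case True
  let ?L = "M - N"
  have "(?L choose (KA - k)) * (?L choose ((KB - k) + (k - j)))
      \<le> (?L choose ((KA - k) + (k - j))) * (?L choose (KB - k))"
    using assms by (intro binomial_log_concave) auto
  then have "(?L choose (KA - k)) * (?L choose (KB - j)) \<le> (?L choose (KA - j)) * (?L choose (KB - k))"
    using True assms by simp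
  then have "real ((?L choose (KA - k)) * (?L choose (KB - j))) / (real (M choose KA) * real (M choose KB))
      \<le> real ((?L choose (KA - j)) * (?L choose (KB - k))) / (real (M choose KA) * real (M choose KB))"
    by (intro divide_right_mono) (simp_all only: of_nat_le_iff, auto)
  then show ?thesis
    using True assms by (simp add: word_prob_def)
qed (simp add: word_prob_def)


section \<open>The threshold rule and its indifference property\<close>

text \<open>The probability of guessing A after \<open>k\<close> ones have been seen.\<close>
definition threshold_rule :: "nat \<Rightarrow> real \<Rightarrow> nat \<Rightarrow> real" where
  "threshold_rule n \<nu> k = (if k < n then 1 else if k = n then \<nu> else 0)"

lemma sum_atMost_split:
  fixes f :: "nat \<Rightarrow> 'a :: comm_monoid_add"
  assumes "n \<le> N"
  shows "sum f {..N} = sum f {..<n} + sum f {n..N}"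
  using assms by (subst sum.union_disjoint[symmetric]) (auto intro!: arg_cong[of _ _ "sum f"])

lemma sum_threshold_rule:
  assumes "n \<le> N"
  shows "(\<Sum>k\<le>N. threshold_rule n \<nu> k * a k) = (\<Sum>k<n. a k) + \<nu> * a n"
proof -
  have "(\<Sum>k=n..N. threshold_rule n \<nu> k * a k) = (\<Sum>k\<in>{n}. threshold_rule n \<nu> k * a k)"
    using assms by (intro sum.mono_neutral_right) (auto simp: threshold_rule_def)
  then show ?thesis
    using assms by (simp add: sum_atMost_split threshold_rule_def)
qed

text \<open>
  With \<open>\<nu>\<close> unknown, the equation between the two winning probabilities is linear, and the given
  \<open>\<nu>\<close> is its solution.
\<close>
lemma threshold_rule_indifferent:
  assumes "n \<le> N" "a n + b n > (0 :: real)"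
    and "\<nu> = ((\<Sum>k=n..N. b k) - (\<Sum>k<n. a k)) / (a n + b n)"
  shows "(\<Sum>k\<le>N. (1 - threshold_rule n \<nu> k) * b k) = (\<Sum>k\<le>N. threshold_rule n \<nu> k * a k)"
proof -
  have "\<nu> * (a n + b n) = (\<Sum>k=n..N. b k) - (\<Sum>k<n. a k)"
    using assms(2,3) by simp
  moreover have "(\<Sum>k\<le>N. (1 - threshold_rule n \<nu> k) * b k) =
      (\<Sum>k\<le>N. b k) - ((\<Sum>k<n. b k) + \<nu> * b n)"
    using sum_threshold_rule[OF assms(1), of \<nu> b] by (simp add: left_diff_distrib sum_subtractf)
  ultimately show ?thesis
    using sum_atMost_split[OF assms(1), of b] sum_threshold_rule[OF assms(1), of \<nu> a]
    by (simp add: algebra_simps)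
qed


section \<open>The critical number of ones\<close>

lemma infsum_int_eq_sum_nat:
  fixes f :: "int \<Rightarrow> real"
  assumes "finite A" "int ` A \<subseteq> I" "\<And>k. k \<in> I \<Longrightarrow> k \<notin> int ` A \<Longrightarrow> f k = 0"
  shows "infsum f I = (\<Sum>k\<in>A. f (int k))"
proof -
  have "infsum f I = infsum f (int ` A)"
    using assms by (intro infsum_cong_neutral) auto
  also have "\<dots> = (\<Sum>k\<in>A. f (int k))"
    using assms(1) by (simp add: sum.reindex o_def)
  finally show ?thesis .
qed

lemma infsum_atMost_int:
  fixes f :: "int \<Rightarrow> real"
  assumes "\<And>k. k < 0 \<Longrightarrow> f k = 0"
  shows "infsum f {..int n} = (\<Sum>k\<le>n. f (int k))"
proof (rule infsum_int_eq_sum_nat)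
  fix k assume "k \<in> {..int n}" "k \<notin> int ` {..n}"
  then show "f k = 0"
    using assms by (cases k) auto
qed auto

lemma infsum_lessThan_int:
  fixes f :: "int \<Rightarrow> real"
  assumes "\<And>k. k < 0 \<Longrightarrow> f k = 0"
  shows "infsum f {..<int n} = (\<Sum>k<n. f (int k))"
proof (rule infsum_int_eq_sum_nat)
  fix k assume "k \<in> {..<int n}" "k \<notin> int ` {..<n}"
  then show "f k = 0"
    using assms by (cases k) auto
qed auto

lemma infsum_atLeast_int:
  fixes f :: "int \<Rightarrow> real"
  assumes "\<And>k. int N < k \<Longrightarrow> f k = 0"
  shows "infsum f {int n..} = (\<Sum>k=n..N. f (int k))"
proof (rule infsum_int_eq_sum_nat)
  fix k assume "k \<in> {int n..}" "k \<notin> int ` {n..N}"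
  then show "f k = 0"
    using assms[of k] by (cases k) (auto simp: image_iff)
qed auto

text \<open>
  The cumulative sum is 0 at negative integers and 2 at \<open>N\<close>, so the least integer at which it
  exceeds 1 exists, although the integers are not well-ordered, and it is a natural number up
  to \<open>N\<close>.
\<close>
lemma kstar_characterization:
  assumes "N \<le> M" "KA \<le> M" "KB \<le> M"
  obtains n where "n \<le> N" "kstar N KA KB M = int n"
    "(\<Sum>k\<le>n. obs_prob N M KA (int k) + obs_prob N M KB (int k)) > 1"
    "(\<Sum>k<n. obs_prob N M KA (int k) + obs_prob N M KB (int k)) \<le> 1"
proof -
  define f where "f k = obs_prob N M KA k + obs_prob N M KB k" for k
  have f0: "f k = 0" if "k < 0" for k
    using that by (simp add: f_def obs_prob_eq_0)
  define F where "F n = (\<Sum>k\<le>n. f (int k))" for n :: nat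
  have "F N = 2"
    using assms by (simp add: F_def f_def sum.distrib sum_obs_prob)
  then have ex: "F N > 1" by simp
  define n where "n = (LEAST n. F n > 1)"
  have n: "F n > 1" and least: "\<And>m. F m > 1 \<Longrightarrow> n \<le> m"
    unfolding n_def using LeastI[of "\<lambda>n. F n > 1", OF ex] by (auto intro: Least_le)
  have "kstar N KA KB M = int n"
    unfolding kstar_def f_def[symmetric]
  proof (rule Least_equality)
    show "infsum f {..int n} > 1"
      using n f0 by (simp add: infsum_atMost_int F_def)
  next
    fix j assume j: "infsum f {..j} > 1"
    show "int n \<le> j"
    proof (cases j)
      case (nonneg m)
      then show ?thesis
        using j f0 least[of m] by (simp add: infsum_atMost_int F_def)
    next
      case (neg m)
      then have "infsum f {..j} = 0"
        by (intro infsum_0) (auto intro: f0)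
      with j show ?thesis by simp
    qed
  qed
  moreover have "(\<Sum>k<n. f (int k)) \<le> 1"
  proof (cases n)
    case (Suc m)
    have "\<not> F m > 1"
      using least[of m] Suc by auto
    then show ?thesis
      by (simp add: F_def Suc lessThan_Suc_atMost)
  qed simp
  ultimately show ?thesis
    using that[of n] n least[OF ex] by (simp add: F_def f_def)
qed


section \<open>Payoffs against the equilibrium strategies\<close>

lemma pmf_A_with_prob:
  assumes "p \<in> {0..1}"
  shows "pmf (A_with_prob p) Scen_A = p" "pmf (A_with_prob p) Scen_B = 1 - p"
proof -
  have "inj (\<lambda>b. if b then Scen_A else Scen_B)"
    by (auto simp: inj_def)
  from pmf_map_inj'[OF this, of "bernoulli_pmf p" True] pmf_map_inj'[OF this, of "bernoulli_pmf p" False]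
  show "pmf (A_with_prob p) Scen_A = p" "pmf (A_with_prob p) Scen_B = 1 - p"
    using assms by (simp_all add: A_with_prob_def)
qed

lemma UNIV_scenario: "(UNIV :: scenario set) = {Scen_A, Scen_B}"
  using scenario.exhaust by auto

lemma not_Scen_A_iff: "s \<noteq> Scen_A \<longleftrightarrow> s = Scen_B"
  by (cases s) auto

lemma finite_scenario: "finite (UNIV :: scenario set)"
  by (simp add: UNIV_scenario)

lemma sum_over_ones_in_samples:
  fixes f :: "nat \<Rightarrow> real"
  assumes "x \<in> allowed M K" "N \<le> M"
  shows "(\<Sum>S\<in>samples N M. f (count_list (nths x S) True)) / real (M choose N) =
    (\<Sum>k\<le>N. f k * obs_prob N M K (int k))"
proof -
  let ?c = "\<lambda>S. count_list (nths x S) True"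
  have "?c S \<le> N" if "S \<in> samples N M" for S
    using assms length_nths_sample(1)[OF that, of x]
    by (intro count_le_of_words) (auto simp: words_def allowed_def)
  then have "(\<Sum>S\<in>samples N M. f (?c S)) = (\<Sum>k\<le>N. \<Sum>S\<in>{S \<in> samples N M. ?c S = k}. f (?c S))"
    by (intro sum.group[symmetric]) (auto simp: finite_samples)
  also have "\<dots> = (\<Sum>k\<le>N. \<Sum>S\<in>{S \<in> samples N M. ?c S = k}. f k)"
    by (intro sum.cong) auto
  also have "\<dots> = (\<Sum>k\<le>N. f k * real ((K choose k) * (M - K choose (N - k))))"
    by (intro sum.cong refl) (simp add: card_samples_with_ones[OF assms(1)])
  finally show ?thesis
    by (simp add: obs_prob_of_nat sum_divide_distrib)
qed

lemma sum_over_observed_word: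
  fixes f :: "bool list \<Rightarrow> real"
  assumes "S \<in> samples N M" "N \<le> M"
  shows "(\<Sum>x\<in>allowed M K. f (nths x S)) / real (M choose K) =
    (\<Sum>w\<in>words N. f w * word_prob N M K (count_list w True))"
proof -
  have "(\<Sum>x\<in>allowed M K. f (nths x S)) = (\<Sum>w\<in>words N. \<Sum>x\<in>{x \<in> allowed M K. nths x S = w}. f (nths x S))"
  proof (rule sum.group[OF finite_allowed finite_words, symmetric])
    show "(\<lambda>x. nths x S) ` allowed M K \<subseteq> words N"
      using length_nths_sample(1)[OF assms(1)] by (auto simp: allowed_def words_def)
  qed
  also have "\<dots> = (\<Sum>w\<in>words N. \<Sum>x\<in>{x \<in> allowed M K. nths x S = w}. f w)"
    by (intro sum.cong) auto
  also have "\<dots> = (\<Sum>w\<in>words N. f w * real (card {x \<in> allowed M K. nths x S = w}))"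
    by (simp add: mult.commute)
  also have "\<dots> / real (M choose K) = (\<Sum>w\<in>words N. f w * word_prob N M K (count_list w True))"
    unfolding sum_divide_distrib
    by (intro sum.cong refl) (simp add: card_allowed_with_word[OF assms(2,1)] word_prob_def)
  finally show ?thesis .
qed

text \<open>
  The guesses at different words are drawn independently, but the bits of \<open>x\<close> show only one word;
  hence only the marginal law of the guess at that word enters.
\<close>
lemma payoff_strategy1:
  assumes "N \<le> M" "length x = M"
  shows "measure_pmf.expectation (strategy1 N KA KB M) (\<lambda>a. utility1 a (s, x)) =
    (\<Sum>S\<in>samples N M. pmf (guess N KA KB M (nths x S)) s) / real (M choose N)"
proof -
  let ?guess = "\<lambda>(S, \<phi>). \<phi> (nths x S) :: scenario"
  note ne = samples_nonempty[OF assms(1)]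
  have word: "nths x S \<in> words N" if "S \<in> samples N M" for S
    using length_nths_sample(1)[OF that assms(2)] by (simp add: words_def)
  have "map_pmf ?guess (strategy1 N KA KB M) =
      pmf_of_set (samples N M) \<bind> (\<lambda>S. map_pmf (\<lambda>\<phi>. \<phi> (nths x S)) (Pi_pmf (words N) undefined (guess N KA KB M)))"
    by (simp add: strategy1_def map_bind_pmf map_pmf_def bind_assoc_pmf bind_return_pmf)
  also have "\<dots> = pmf_of_set (samples N M) \<bind> (\<lambda>S. guess N KA KB M (nths x S))"
    using word ne
    by (intro bind_pmf_cong refl) (simp add: Pi_pmf_component finite_words finite_samples)
  finally have law: "map_pmf ?guess (strategy1 N KA KB M) = \<dots>" .
  have "measure_pmf.expectation (strategy1 N KA KB M) (\<lambda>a. utility1 a (s, x)) =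
      measure_pmf.expectation (strategy1 N KA KB M) (indicator (?guess -` {s}))"
    by (intro Bochner_Integration.integral_cong) (auto simp: indicator_def)
  also have "\<dots> = pmf (map_pmf ?guess (strategy1 N KA KB M)) s"
    by (simp add: pmf_map)
  also have "\<dots> = (\<Sum>S\<in>samples N M. pmf (guess N KA KB M (nths x S)) s) / real (M choose N)"
    unfolding law by (simp add: pmf_bind integral_pmf_of_set ne finite_samples card_samples)
  finally show ?thesis .
qed

lemma payoff_strategy2:
  assumes "N \<le> M" "KA \<le> M" "KB \<le> M" "S \<in> samples N M" and P: "Pstar N KA KB M \<in> {0..1}"
  shows "measure_pmf.expectation (strategy2 N KA KB M) (utility1 (S, \<phi>)) =
    (\<Sum>w\<in>words N.
       (if \<phi> w = Scen_A then Pstar N KA KB M * word_prob N M KA (count_list w True)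
        else (1 - Pstar N KA KB M) * word_prob N M KB (count_list w True)))"
proof -
  let ?K = "num_ones KA KB" and ?hit = "\<lambda>s w. if \<phi> w = s then 1 else 0 :: real"
  have ne: "allowed M (?K s) \<noteq> {}" for s
    using assms by (cases s) (simp_all add: allowed_nonempty)
  have "strategy2 N KA KB M =
      A_with_prob (Pstar N KA KB M) \<bind> (\<lambda>s. map_pmf (Pair s) (pmf_of_set (allowed M (?K s))))"
    by (simp add: strategy2_def map_pmf_def)
  moreover have "measure_pmf.expectation \<dots> (utility1 (S, \<phi>)) =
      (\<Sum>s\<in>UNIV. pmf (A_with_prob (Pstar N KA KB M)) s *\<^sub>R
         measure_pmf.expectation (map_pmf (Pair s) (pmf_of_set (allowed M (?K s)))) (utility1 (S, \<phi>)))"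
    by (rule pmf_expectation_bind) (simp_all add: finite_scenario ne finite_allowed)
  ultimately have "measure_pmf.expectation (strategy2 N KA KB M) (utility1 (S, \<phi>)) =
      (\<Sum>s\<in>UNIV. pmf (A_with_prob (Pstar N KA KB M)) s *
         measure_pmf.expectation (map_pmf (Pair s) (pmf_of_set (allowed M (?K s)))) (utility1 (S, \<phi>)))"
    by simp
  also have "\<dots> = (\<Sum>s\<in>UNIV. pmf (A_with_prob (Pstar N KA KB M)) s *
      ((\<Sum>x\<in>allowed M (?K s). ?hit s (nths x S)) / real (M choose ?K s)))"
    by (simp add: integral_pmf_of_set ne finite_allowed card_allowed)
  also have "\<dots> = (\<Sum>s\<in>UNIV. pmf (A_with_prob (Pstar N KA KB M)) s *
      (\<Sum>w\<in>words N. ?hit s w * word_prob N M (?K s) (count_list w True)))"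
    by (simp only: sum_over_observed_word[OF assms(4,1), where f = "?hit _"])
  also have "\<dots> = (\<Sum>w\<in>words N. Pstar N KA KB M * (?hit Scen_A w * word_prob N M KA (count_list w True))
      + (1 - Pstar N KA KB M) * (?hit Scen_B w * word_prob N M KB (count_list w True)))"
    by (simp add: UNIV_scenario pmf_A_with_prob[OF P] sum_distrib_left sum.distrib)
  also have "\<dots> = (\<Sum>w\<in>words N.
       (if \<phi> w = Scen_A then Pstar N KA KB M * word_prob N M KA (count_list w True)
        else (1 - Pstar N KA KB M) * word_prob N M KB (count_list w True)))"
    by (intro sum.cong refl) (auto simp: not_Scen_A_iff)
  finally show ?thesis .
qed

lemma pmf_guess:
  assumes "kstar N KA KB M = int n" "nustar N KA KB M \<in> {0..1}"
  shows "pmf (guess N KA KB M w) Scen_A = threshold_rule n (nustar N KA KB M) (count_list w True)"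
    and "pmf (guess N KA KB M w) Scen_B = 1 - threshold_rule n (nustar N KA KB M) (count_list w True)"
  using assms(1) pmf_A_with_prob[OF assms(2)]
  by (auto simp: guess_def threshold_rule_def Let_def)


section \<open>The equilibrium\<close>

lemma strategy1_in_mixed:
  assumes "N \<le> M"
  shows "strategy1 N KA KB M \<in> mixed (actions1 N M)"
proof -
  have "set_pmf (Pi_pmf (words N) undefined (guess N KA KB M)) \<subseteq> words N \<rightarrow>\<^sub>E UNIV"
    using set_Pi_pmf_subset[OF finite_words[of N], of undefined "guess N KA KB M"]
    by (auto simp: PiE_def extensional_def)
  then show ?thesis
    by (auto simp: mixed_def strategy1_def actions1_def finite_samples samples_nonempty assms)
qed

lemma strategy2_in_mixed:
  assumes "KA \<le> M" "KB \<le> M"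
  shows "strategy2 N KA KB M \<in> mixed (actions2 KA KB M)"
proof -
  have "allowed M (num_ones KA KB s) \<noteq> {}" for s
    using assms by (cases s) (simp_all add: allowed_nonempty)
  then show ?thesis
    by (auto simp: mixed_def strategy2_def actions2_def finite_allowed)
qed

lemma finite_actions1: "finite (actions1 N M)"
  by (auto simp: actions1_def finite_samples finite_words UNIV_scenario intro!: finite_PiE)

lemma finite_actions2: "finite (actions2 KA KB M)"
  by (auto simp: actions2_def finite_allowed UNIV_scenario)

theorem theorem2p1:
  fixes N KA KB M :: nat
  assumes "N \<le> M" and "KA < KB" and "KB \<le> M"
  shows
    "(\<Sum>\<^sub>\<infinity>k\<in>{..kstar N KA KB M}. obs_prob N M KA k + obs_prob N M KB k) > 1 \<and>
     (\<Sum>\<^sub>\<infinity>k\<in>{..<kstar N KA KB M}. obs_prob N M KA k + obs_prob N M KB k) \<le> 1 \<and>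
     Pstar N KA KB M \<in> {0..1} \<and> nustar N KA KB M \<in> {0..1} \<and>
     fisher_nash N KA KB M (strategy1 N KA KB M) (strategy2 N KA KB M)"
proof -
  have KM: "KA \<le> M" "KB \<le> M"
    using assms by auto
  define a where "a k = obs_prob N M KA (int k)" for k :: nat
  define b where "b k = obs_prob N M KB (int k)" for k :: nat
  define P where "P = Pstar N KA KB M"
  define \<nu> where "\<nu> = nustar N KA KB M"
  have nonneg: "a k \<ge> 0" "b k \<ge> 0" for k
    by (simp_all add: a_def b_def obs_prob_nonneg)
  obtain n where n: "n \<le> N" "kstar N KA KB M = int n"
      and gt: "(\<Sum>k\<le>n. a k + b k) > 1" and le: "(\<Sum>k<n. a k + b k) \<le> 1"
    using kstar_characterization[OF assms(1) KM] unfolding a_def b_def by blast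
  have pos: "a n + b n > 0"
    using gt le by (simp flip: lessThan_Suc_atMost)
  have P_eq: "P = b n / (a n + b n)"
    by (simp add: P_def Pstar_def Let_def n(2) a_def b_def)
  have \<nu>_eq: "\<nu> = ((\<Sum>k=n..N. b k) - (\<Sum>k<n. a k)) / (a n + b n)"
    by (simp add: \<nu>_def nustar_def Let_def n(2) a_def b_def infsum_lessThan_int infsum_atLeast_int[of N]
        obs_prob_eq_0)
  have P01: "P \<in> {0..1}"
    using pos nonneg[of n] by (simp add: P_eq)
  have num: "(\<Sum>k=n..N. b k) - (\<Sum>k<n. a k) = 1 - (\<Sum>k<n. a k + b k)"
    using sum_atMost_split[OF n(1), of b] sum_obs_prob[OF assms(1) KM(2)]
    by (simp add: b_def sum.distrib)
  have \<nu>01: "\<nu> \<in> {0..1}"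
    using pos gt le unfolding \<nu>_eq num by (simp flip: lessThan_Suc_atMost)
  \<comment> \<open>The value of the game, written as Player 1's winning probability in scenario A.\<close>
  define v where "v = (\<Sum>k\<le>N. threshold_rule n \<nu> k * a k)"
  have v_B: "(\<Sum>k\<le>N. (1 - threshold_rule n \<nu> k) * b k) = v"
    unfolding v_def by (rule threshold_rule_indifferent[where a = a, OF n(1) pos \<nu>_eq])

  have secure: "v \<le> measure_pmf.expectation (strategy1 N KA KB M) (\<lambda>a. utility1 a y)"
    if y_mem: "y \<in> actions2 KA KB M" for y
  proof -
    obtain s x where y: "y = (s, x)" "x \<in> allowed M (num_ones KA KB s)"
      using y_mem by (auto simp: actions2_def)
    define t where "t k = (case s of Scen_A \<Rightarrow> threshold_rule n \<nu> k | Scen_B \<Rightarrow> 1 - threshold_rule n \<nu> k)" for k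
    have t: "pmf (guess N KA KB M w) s = t (count_list w True)" for w
      using pmf_guess[OF n(2) \<nu>01[unfolded \<nu>_def]] by (cases s) (auto simp: t_def \<nu>_def)
    have "measure_pmf.expectation (strategy1 N KA KB M) (\<lambda>a. utility1 a y) =
        (\<Sum>k\<le>N. t k * obs_prob N M (num_ones KA KB s) (int k))"
      using payoff_strategy1[OF assms(1), of x KA KB s] sum_over_ones_in_samples[OF y(2) assms(1), of t] y
      by (simp add: t allowed_def)
    also have "\<dots> = v"
      using v_B by (cases s) (auto simp: t_def v_def a_def b_def)
    finally show ?thesis by simp
  qed

  define qA where "qA = word_prob N M KA"
  define qB where "qB = word_prob N M KB"
  have ab: "a k = real (N choose k) * qA k" "b k = real (N choose k) * qB k" if "k \<le> N" for k
    using obs_prob_eq_word_prob[OF assms(1) _ that] KM by (simp_all add: a_def b_def qA_def qB_def)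
  have mlr: "qA k * qB j \<le> qA j * qB k" if "j \<le> k" for j k
    unfolding qA_def qB_def using assms that by (intro word_prob_monotone_likelihood_ratio) auto
  \<comment> \<open>At \<open>k = n\<close> the two right-hand sides coincide: the prior is chosen so that the posterior
    probabilities balance after \<open>n\<close> ones. For other \<open>k\<close> they are compared by the likelihood ratio.\<close>
  have post: "P * qA k * (a n + b n) = real (N choose n) * (qA k * qB n)"
     "(1 - P) * qB k * (a n + b n) = real (N choose n) * (qA n * qB k)" for k
    using pos ab[OF n(1)] by (simp_all add: P_eq field_simps)
  have A_better: "(1 - P) * qB k \<le> P * qA k" if "k \<le> n" for k
  proof -
    have "(1 - P) * qB k * (a n + b n) \<le> P * qA k * (a n + b n)"
      unfolding post by (intro mult_left_mono mlr that) simp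
    then show ?thesis using pos by simp
  qed
  have B_better: "P * qA k \<le> (1 - P) * qB k" if "n \<le> k" for k
  proof -
    have "P * qA k * (a n + b n) \<le> (1 - P) * qB k * (a n + b n)"
      unfolding post by (intro mult_left_mono mlr that) simp
    then show ?thesis using pos by simp
  qed
  \<comment> \<open>The contribution of one word with \<open>k\<close> ones when the guess follows the threshold rule; it is the
    larger of the contributions of the two pure guesses.\<close>
  define best where "best k = threshold_rule n \<nu> k * (P * qA k) + (1 - threshold_rule n \<nu> k) * ((1 - P) * qB k)" for k
  have best: "P * qA k \<le> best k" "(1 - P) * qB k \<le> best k" for k
  proof -
    consider "k < n" | "k = n" | "n < k"
      by linarith
    then have "P * qA k \<le> best k \<and> (1 - P) * qB k \<le> best k"
    proof cases
      case 1
      then have "best k = P * qA k" by (simp add: best_def threshold_rule_def)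
      then show ?thesis using A_better[of k] 1 by linarith
    next
      case 2
      have eq: "(1 - P) * qB n = P * qA n"
        by (intro antisym A_better B_better) auto
      have best_n: "best n = P * qA n"
        unfolding best_def eq by (simp add: algebra_simps)
      show ?thesis
        unfolding 2 best_n eq by simp
    next
      case 3
      then have "best k = (1 - P) * qB k" by (simp add: best_def threshold_rule_def)
      then show ?thesis using B_better[of k] 3 by linarith
    qed
    then show "P * qA k \<le> best k" "(1 - P) * qB k \<le> best k" by auto
  qed
  have cap: "measure_pmf.expectation (strategy2 N KA KB M) (utility1 c) \<le> v"
    if c_mem: "c \<in> actions1 N M" for c
  proof -
    obtain S \<phi> where c: "c = (S, \<phi>)" "S \<in> samples N M"
      using c_mem by (auto simp: actions1_def)
    have "measure_pmf.expectation (strategy2 N KA KB M) (utility1 c) =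
        (\<Sum>w\<in>words N. if \<phi> w = Scen_A then P * qA (count_list w True) else (1 - P) * qB (count_list w True))"
      unfolding c(1) P_def qA_def qB_def
      by (rule payoff_strategy2[OF assms(1) KM c(2) P01[unfolded P_def]])
    also have "\<dots> \<le> (\<Sum>w\<in>words N. best (count_list w True))"
      by (intro sum_mono) (simp add: best)
    also have "\<dots> = (\<Sum>k\<le>N. real (N choose k) * best k)"
      by (rule sum_words_by_ones)
    also have "\<dots> = (\<Sum>k\<le>N. P * (threshold_rule n \<nu> k * a k) + (1 - P) * ((1 - threshold_rule n \<nu> k) * b k))"
      by (intro sum.cong refl) (simp add: best_def ab algebra_simps)
    also have "\<dots> = P * v + (1 - P) * (\<Sum>k\<le>N. (1 - threshold_rule n \<nu> k) * b k)"
      by (simp only: sum.distrib v_def sum_distrib_left)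
    also have "\<dots> = v"
      unfolding v_B by (simp add: algebra_simps)
    finally show ?thesis .
  qed

  have zero_sum: "utility2 = (\<lambda>a b. 1 - utility1 a b)"
    by (intro ext) (simp add: utility2_def)
  have "fisher_nash N KA KB M (strategy1 N KA KB M) (strategy2 N KA KB M)"
    unfolding fisher_nash_def zero_sum
    by (rule mixed_nash_saddle_point[OF finite_actions1 finite_actions2
          strategy1_in_mixed[OF assms(1)] strategy2_in_mixed[OF KM] secure cap])
  then show ?thesis
    using gt le P01 \<nu>01
    by (simp add: n(2) infsum_atMost_int infsum_lessThan_int obs_prob_eq_0 a_def b_def P_def \<nu>_def)
qed

end
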